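(* Let $q$ be a prime power and $n$ a positive integer, and let $N=\frac{q^n-1}{q-1}$, $N'=N-n$, $k=q^{n-1}-1$. Then the $k$ highest-degree terms of the polynomial $\chi_{PG(n-1,q)^*}(x)$ are $$x^{N'}-N x^{N'-1}+\binom{N}{2}x^{N'-2}-\ldots+(-1)^{k-1}\binom{N}{k-1}x^{N'-k+1}.$$ That is, $\chi_{PG(n-1,q)^*}(x)$ has no terms of degree greater than $N'$, and for every integer $i$ with $0\le i\le k-1$ the coefficient of $x^{N'-i}$ in it equals $(-1)^i\binom{N}{i}$.
   Context: $PG(n-1,q)$ denotes the matroid whose ground set $E$ is the set of all points of the $(n-1)$-dimensional projective space over the finite field $\mathbb{F}_q$ (i.e. the one-dimensional subspaces of $\mathbb{F}_q^n$), the rank $r(A)$ of $A\subseteq E$ being the dimension of the linear subspace of $\mathbb{F}_q^n$ spanned by $A$. The dual $M^*=(E,r^* )$ of a matroid $M=(E,r)$ has rank function $r^*(A)=r(E-A)+|A|-r(E)$, and the characteristic polynomial of a matroid $M=(E,r)$ is $\chi_M(x)=\sum_{A\subseteq E}(-1)^{|A|}x^{r(E)-r(A)}$. *)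

theory Defs
  imports
    "HOL-Analysis.Analysis"
    "HOL-Computational_Algebra.Polynomial"
    "HOL-Number_Theory.Prime_Powers"
begin

(* A matroid is given by a ground set and a rank function; only the values of the rank
   function on subsets of the ground set are meaningful. *)
locale matroid =
  fixes E :: "'e set" and r :: "'e set \<Rightarrow> nat"
  assumes finite_ground: "finite E"
    and rank_le_card: "A \<subseteq> E \<Longrightarrow> r A \<le> card A"
    and rank_mono: "A \<subseteq> B \<Longrightarrow> B \<subseteq> E \<Longrightarrow> r A \<le> r B"
    and rank_submodular:
      "A \<subseteq> E \<Longrightarrow> B \<subseteq> E \<Longrightarrow> r (A \<union> B) + r (A \<inter> B) \<le> r A + r B"

(* The subtraction is on naturals, but does not truncate on matroids:
   see rank_le_rank_compl_plus_card below. *)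
definition dual_rank :: "'e set \<Rightarrow> ('e set \<Rightarrow> nat) \<Rightarrow> 'e set \<Rightarrow> nat" where
  "dual_rank E r A = r (E - A) + card A - r E"

(* The exponent does not truncate, by rank_mono. *)
definition char_poly :: "'e set \<Rightarrow> ('e set \<Rightarrow> nat) \<Rightarrow> int poly" where
  "char_poly E r = (\<Sum>A\<in>Pow E. monom ((-1) ^ card A) (r E - r A))"

(* Points of the projective space of the vector space 'a ^ 'n, that is, of
   PG(CARD('n) - 1, CARD('a)); vec.span, vec.dim are the notions for 'a-linear algebra. *)
definition PG_points :: "('a::{field,finite} ^ 'n) set set" where
  "PG_points = {L. vec.subspace L \<and> vec.dim L = 1}"

definition PG_rank :: "('a::{field,finite} ^ 'n) set set \<Rightarrow> nat" where
  "PG_rank A = vec.dim (vec.span (\<Union>A))"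

lemma (in matroid) rank_le_rank_compl_plus_card:
  assumes "A \<subseteq> E"
  shows "r E \<le> r (E - A) + card A"
proof -
  have "r ((E - A) \<union> A) + r ((E - A) \<inter> A) \<le> r (E - A) + r A"
    using assms by (intro rank_submodular) auto
  moreover have "(E - A) \<union> A = E"
    using assms by auto
  ultimately show ?thesis
    using rank_le_card[OF assms] by simp
qed

lemma (in matroid) matroid_dual: "matroid E (dual_rank E r)"
proof
  show "finite E"
    by (rule finite_ground)
next
  fix A assume "A \<subseteq> E"
  then show "dual_rank E r A \<le> card A"
    using rank_mono[of "E - A" E] by (simp add: dual_rank_def)
next
  fix A B assume AB: "A \<subseteq> B" "B \<subseteq> E"
  have fin: "finite B"
    using AB finite_ground finite_subset by blast
  have "r ((E - B) \<union> (B - A)) + r ((E - B) \<inter> (B - A)) \<le> r (E - B) + r (B - A)"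
    using AB by (intro rank_submodular) auto
  moreover have "(E - B) \<union> (B - A) = E - A"
    using AB by auto
  moreover have "r (B - A) \<le> card (B - A)"
    using AB by (intro rank_le_card) auto
  moreover have "card (B - A) + card A = card B"
    using AB fin by (metis card_Diff_subset card_mono finite_subset le_add_diff_inverse2)
  ultimately show "dual_rank E r A \<le> dual_rank E r B"
    by (simp add: dual_rank_def)
next
  fix A B assume AB: "A \<subseteq> E" "B \<subseteq> E"
  have fin: "finite A" "finite B"
    using AB finite_ground finite_subset by blast+
  have "r ((E - A) \<union> (E - B)) + r ((E - A) \<inter> (E - B)) \<le> r (E - A) + r (E - B)"
    by (intro rank_submodular) auto
  moreover have "(E - A) \<union> (E - B) = E - (A \<inter> B)" "(E - A) \<inter> (E - B) = E - (A \<union> B)"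
    by auto
  moreover have "card A + card B = card (A \<union> B) + card (A \<inter> B)"
    using fin by (rule card_Un_Int)
  moreover have "r E \<le> r (E - (A \<union> B)) + card (A \<union> B)" "r E \<le> r (E - (A \<inter> B)) + card (A \<inter> B)"
    using AB by (auto intro!: rank_le_rank_compl_plus_card)
  ultimately show
    "dual_rank E r (A \<union> B) + dual_rank E r (A \<inter> B) \<le> dual_rank E r A + dual_rank E r B"
    by (simp add: dual_rank_def)
qed

lemma matroid_PG: "matroid (PG_points :: ('a::{field,finite} ^ 'n) set set) PG_rank"
proof
  show "finite (PG_points :: ('a ^ 'n) set set)"
    by simp
next
  fix A :: "('a ^ 'n) set set"
  assume A: "A \<subseteq> PG_points"
  have "\<exists>v. L = vec.span {v}" if "L \<in> A" for L
  proof -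
    have L: "vec.subspace L" "vec.dim L = 1"
      using A that by (auto simp: PG_points_def)
    obtain B where B: "B \<subseteq> L" "vec.independent B" "L \<subseteq> vec.span B" "card B = vec.dim L"
      using vec.basis_exists by blast
    then obtain v where "B = {v}"
      using L by (auto simp: card_1_singleton_iff)
    then show ?thesis
      using B L by (metis vec.span_minimal subset_antisym)
  qed
  then obtain v where v: "\<And>L. L \<in> A \<Longrightarrow> L = vec.span {v L}"
    by metis
  have "\<Union>A \<subseteq> vec.span (v ` A)"
  proof
    fix x assume "x \<in> \<Union>A"
    then obtain L where "L \<in> A" "x \<in> vec.span {v L}"
      using v by blast
    then show "x \<in> vec.span (v ` A)"
      using vec.span_mono[of "{v L}" "v ` A"] by auto
  qed
  then have "vec.dim (\<Union>A) \<le> card (v ` A)"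
    by (intro vec.dim_le_card) auto
  also have "\<dots> \<le> card A"
    by (intro card_image_le) simp
  finally show "PG_rank A \<le> card A"
    by (simp add: PG_rank_def)
next
  fix A B :: "('a ^ 'n) set set"
  assume "A \<subseteq> B"
  then show "PG_rank A \<le> PG_rank B"
    unfolding PG_rank_def by (simp add: Union_mono vec.dim_subset)
next
  fix A B :: "('a ^ 'n) set set"
  let ?S = "vec.span (\<Union>A)" and ?T = "vec.span (\<Union>B)"
  have "vec.dim (vec.span (\<Union>(A \<union> B))) + vec.dim (?S \<inter> ?T) = vec.dim ?S + vec.dim ?T"
    using vec.dim_sums_Int[of ?S ?T] by (simp only: Union_Un_distrib vec.span_Un vec.subspace_span)
  moreover have "vec.span (\<Union>(A \<inter> B)) \<subseteq> ?S \<inter> ?T"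
    by (intro Int_greatest vec.span_mono) auto
  then have "vec.dim (vec.span (\<Union>(A \<inter> B))) \<le> vec.dim (?S \<inter> ?T)"
    by (rule vec.dim_subset)
  ultimately show "PG_rank (A \<union> B) + PG_rank (A \<inter> B) \<le> PG_rank A + PG_rank B"
    unfolding PG_rank_def by linarith
qed

end

(* In the dual matroid a set A has rank card A as soon as its complement spans. A set of points
   whose complement does not span contains the complement of a hyperplane, hence has at least
   q^(n-1) elements. So all sets of at most k = q^(n-1) - 1 points are independent in the dual,
   and for i < k the sets of dual rank i are exactly the N choose i sets of cardinality i. *)
theory Submission
  imports Defs
begin

lemma (in matroid) degree_char_poly_le: "degree (char_poly E r) \<le> r E"
  unfolding char_poly_def
proof (rule degree_sum_le)
  show "finite (Pow E)"
    using finite_ground by simp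
  show "degree (monom ((-1 :: int) ^ card A) (r E - r A)) \<le> r E" for A
    by (rule order.trans[OF degree_monom_le]) simp
qed

text \<open>By monotonicity, sets with more than \<open>k\<close> elements have rank at least
  \<open>k\<close>. Hence a rank \<open>i < k\<close> is attained exactly by the
  \<open>i\<close>-element sets, and each of these contributes the same sign to the
  coefficient.\<close>

lemma (in matroid) coeff_char_poly_of_small_sets_independent:
  assumes indep: "\<And>A. A \<subseteq> E \<Longrightarrow> card A \<le> k \<Longrightarrow> r A = card A"
    and "k \<le> card E" "i < k"
  shows "coeff (char_poly E r) (r E - i) = (-1) ^ i * int (card E choose i)"
proof -
  have rank_ge: "j \<le> r A" if A: "A \<subseteq> E" and j: "j \<le> card A" "j \<le> k" for A j
  proof -
    obtain B where "B \<subseteq> A" "card B = j"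
      using obtain_subset_with_card_n[OF j(1)] by metis
    with A j(2) indep[of B] rank_mono[of B A] show ?thesis
      by auto
  qed
  have rank_eq_iff: "r E - r A = r E - i \<longleftrightarrow> card A = i" if A: "A \<subseteq> E" for A
  proof -
    \<comment> \<open>Together with \<open>i < k\<close>, these bounds exclude truncation in both
      exponents, so equal exponents mean equal ranks.\<close>
    have "r A \<le> r E" "k \<le> r E"
      using rank_mono[OF A] rank_ge[of E k] \<open>k \<le> card E\<close> by auto
    then have "r E - r A = r E - i \<longleftrightarrow> r A = i"
      using \<open>i < k\<close> by auto
    also have "\<dots> \<longleftrightarrow> card A = i"
      \<comment> \<open>As \<open>Suc i \<le> k\<close>, a set with more than \<open>i\<close>
        elements has rank at least \<open>Suc i\<close>. So rank \<open>i\<close> forces at most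
        \<open>i\<close> elements, where rank and cardinality agree.\<close>
      using indep[OF A] rank_ge[OF A, of "Suc i"] \<open>i < k\<close> by fastforce
    finally show ?thesis .
  qed
  have "coeff (char_poly E r) (r E - i) =
      (\<Sum>A\<in>Pow E. if r E - r A = r E - i then (-1) ^ card A else 0)"
    by (simp add: char_poly_def coeff_sum)
  also have "\<dots> = (\<Sum>A\<in>Pow E. if card A = i then (-1) ^ i else 0)"
    by (intro sum.cong) (auto simp: rank_eq_iff)
  also have "\<dots> = (\<Sum>A\<in>{A. A \<subseteq> E \<and> card A = i}. (-1) ^ i)"
    using finite_ground by (simp add: sum.inter_filter[symmetric] Pow_def)
  finally show ?thesis
    using finite_ground by (simp add: n_subsets)
qed

lemma PG_points_eq: "PG_points = (\<lambda>v. vec.span {v}) ` (UNIV - {0 :: 'a::{field,finite} ^ 'n})"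
proof (intro equalityI subsetI)
  fix L :: "('a ^ 'n) set"
  assume "L \<in> PG_points"
  then have L: "vec.subspace L" "vec.dim L = 1"
    by (auto simp: PG_points_def)
  obtain B where B: "B \<subseteq> L" "vec.independent B" "L \<subseteq> vec.span B" "card B = vec.dim L"
    using vec.basis_exists by blast
  with L obtain v where v: "B = {v}"
    by (auto simp: card_1_singleton_iff)
  have "L = vec.span {v}"
    using B L v by (metis vec.span_minimal subset_antisym)
  moreover have "v \<noteq> 0"
    using B v vec.dependent_zero by auto
  ultimately show "L \<in> (\<lambda>v. vec.span {v}) ` (UNIV - {0})"
    by auto
next
  fix L :: "('a ^ 'n) set"
  assume "L \<in> (\<lambda>v. vec.span {v}) ` (UNIV - {0})"
  then show "L \<in> PG_points"
    by (auto simp: PG_points_def vec.dim_eq_card_independent)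
qed

lemma card_PG_point:
  fixes L :: "('a::{field,finite} ^ 'n) set"
  assumes "L \<in> PG_points"
  shows "card L = CARD('a)"
proof -
  obtain v where "v \<noteq> 0" and L: "L = range (\<lambda>c. c *s v)"
    using assms by (auto simp: PG_points_eq vec.span_singleton)
  then have "inj (\<lambda>c. c *s v)"
    by (auto intro!: injI)
  then show ?thesis
    by (simp add: L card_image)
qed

lemma zero_in_PG_point: "L \<in> PG_points \<Longrightarrow> 0 \<in> L"
  by (auto simp: PG_points_eq vec.span_zero)

text \<open>A line contained in a one-dimensional space equals it. Consequently two distinct points
  of the projective space meet only in the zero vector.\<close>

lemma span_singleton_eq_PG_point:
  assumes "L \<in> PG_points" "x \<in> L" "x \<noteq> 0"
  shows "vec.span {x} = L"
proof (rule vec.subspace_dim_equal)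
  show "vec.span {x} \<subseteq> L"
    using assms by (intro vec.span_minimal) (auto simp: PG_points_def)
qed (use assms in \<open>auto simp: PG_points_def vec.dim_eq_card_independent\<close>)

text \<open>The points, with zero removed, partition the nonzero vectors into blocks of size
  \<open>CARD('a) - 1\<close>.\<close>

lemma card_PG_points:
  "card (PG_points :: ('a::{field,finite} ^ 'n) set set) * (CARD('a) - 1) = CARD('a) ^ CARD('n) - 1"
proof -
  let ?E = "PG_points :: ('a ^ 'n) set set"
  have cover: "(\<Union>L\<in>?E. L - {0}) = UNIV - {0}"
    by (auto simp: PG_points_eq intro: vec.span_base)
  have "CARD('a) ^ CARD('n) - 1 = card (UNIV - {0 :: 'a ^ 'n})"
    by (simp add: card_Diff_singleton)
  also have "\<dots> = (\<Sum>L\<in>?E. card (L - {0}))"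
    unfolding cover[symmetric]
  proof (rule card_UN_disjoint)
    show "\<forall>L\<in>?E. \<forall>M\<in>?E. L \<noteq> M \<longrightarrow> (L - {0}) \<inter> (M - {0}) = {}"
      using span_singleton_eq_PG_point by blast
  qed auto
  also have "\<dots> = (\<Sum>L\<in>?E. CARD('a) - 1)"
    by (intro sum.cong) (auto simp: card_PG_point zero_in_PG_point card_Diff_singleton)
  finally show ?thesis
    by simp
qed

lemma PG_rank_PG_points: "PG_rank (PG_points :: ('a::{field,finite} ^ 'n) set set) = CARD('n)"
proof -
  have "x \<in> \<Union>PG_points" if "x \<noteq> 0" for x :: "'a ^ 'n"
    using that by (auto simp: PG_points_eq intro: vec.span_base)
  then have "x \<in> vec.span (\<Union>PG_points)" for x :: "'a ^ 'n"
    by (cases "x = 0") (auto intro: vec.span_base vec.span_zero)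
  then have "vec.span (\<Union>PG_points) = (UNIV :: ('a ^ 'n) set)"
    by auto
  then show ?thesis
    unfolding PG_rank_def by (simp only: vec_dim_card)
qed

text \<open>For \<open>x\<close> outside \<open>S\<close>, the cosets \<open>c *s x + S\<close> with
  \<open>c\<close> ranging over the field are pairwise disjoint, so \<open>CARD('a)\<close> copies
  of \<open>S\<close> fit into the whole space.\<close>

lemma card_proper_subspace_le:
  fixes S :: "('a::{field,finite} ^ 'n) set"
  assumes "vec.subspace S" "S \<noteq> UNIV"
  shows "card S \<le> CARD('a) ^ (CARD('n) - 1)"
proof -
  obtain x where x: "x \<notin> S"
    using assms by auto
  have "inj_on (\<lambda>(c, s). c *s x + s) (UNIV \<times> S)"
  proof (rule inj_onI, clarify)
    fix c s d t
    assume st: "s \<in> S" "t \<in> S" and eq: "c *s x + s = d *s x + t"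
    have "(c - d) *s x = t - s"
      using eq by (simp add: vec.scale_left_diff_distrib algebra_simps)
    then have "(c - d) *s x \<in> S"
      using st assms by (simp add: vec.subspace_diff)
    \<comment> \<open>If \<open>c\<close> and \<open>d\<close> differed, this vector would be
      \<open>x\<close>, which lies outside \<open>S\<close>.\<close>
    then have "inverse (c - d) *s ((c - d) *s x) \<in> S"
      by (rule vec.subspace_scale[OF assms(1)])
    then have "(inverse (c - d) * (c - d)) *s x \<in> S"
      by (simp only: vec.scale_scale)
    then have "c = d"
      using x by (cases "c = d") simp_all
    with eq show "c = d \<and> s = t"
      by simp
  qed
  then have "card ((UNIV :: 'a set) \<times> S) \<le> card (UNIV :: ('a ^ 'n) set)"
    by (rule card_inj_on_le) auto
  then have "CARD('a) * card S \<le> CARD('a) ^ CARD('n)"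
    by (simp add: card_cartesian_product)
  also have "\<dots> = CARD('a) * CARD('a) ^ (CARD('n) - 1)"
    by (simp flip: power_Suc)
  finally show ?thesis
    by simp
qed

text \<open>Every vector outside the span of the remaining points lies on a point of
  \<open>A\<close>. With q = \<open>CARD('a)\<close> and n = \<open>CARD('n)\<close>, there are at
  least q^n - q^(n-1) = q^(n-1) (q-1) such vectors, and each point carries only q-1 nonzero
  ones.\<close>

lemma card_ge_if_complement_not_spanning:
  fixes A :: "('a::{field,finite} ^ 'n) set set"
  assumes A: "A \<subseteq> PG_points" and rank: "PG_rank (PG_points - A) < CARD('n)"
  shows "CARD('a) ^ (CARD('n) - 1) \<le> card A"
proof -
  let ?q = "CARD('a)" and ?n = "CARD('n)"
  let ?S = "vec.span (\<Union>(PG_points - A))"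
  have "card {0, 1 :: 'a} \<le> ?q"
    by (intro card_mono) auto
  then have q: "2 \<le> ?q"
    by simp
  have "?S \<noteq> UNIV"
    using rank vec_dim_card[where 'a='a and 'n='n] unfolding PG_rank_def by force
  then have S: "card ?S \<le> ?q ^ (?n - 1)"
    by (intro card_proper_subspace_le) auto
  have "UNIV - ?S \<subseteq> (\<Union>L\<in>A. L - {0})"
  proof
    fix x assume x: "x \<in> UNIV - ?S"
    then have "x \<noteq> 0"
      using vec.span_zero by blast
    then have "vec.span {x} \<in> PG_points"
      by (auto simp: PG_points_eq)
    moreover have "x \<in> vec.span {x}"
      by (simp add: vec.span_base)
    \<comment> \<open>Hence the point spanned by \<open>x\<close> cannot be among the remaining
      points and must belong to \<open>A\<close>.\<close>
    moreover have "x \<notin> \<Union>(PG_points - A)"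
      using vec.span_base[of x] DiffD2[OF x] by metis
    ultimately show "x \<in> (\<Union>L\<in>A. L - {0})"
      using \<open>x \<noteq> 0\<close> by blast
  qed
  then have "card (UNIV - ?S) \<le> card (\<Union>L\<in>A. L - {0})"
    by (intro card_mono) auto
  also have "\<dots> \<le> (\<Sum>L\<in>A. card (L - {0}))"
    by (intro card_UN_le) simp
  also have "\<dots> = (\<Sum>L\<in>A. ?q - 1)"
    using A by (intro sum.cong) (auto simp: card_PG_point zero_in_PG_point card_Diff_singleton)
  finally have "?q ^ ?n - card ?S \<le> card A * (?q - 1)"
    by (simp add: card_Diff_subset)
  moreover have "?q ^ ?n = ?q ^ (?n - 1) * (?q - 1) + ?q ^ (?n - 1)"
    using q power_minus_mult[of ?n ?q] by (cases ?q) (auto simp: add.commute)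
  ultimately have "?q ^ (?n - 1) * (?q - 1) \<le> card A * (?q - 1)"
    using S by linarith
  then show ?thesis
    using q by simp
qed

theorem corollary3:
  fixes q n N N' k :: nat
    and E :: "('a::{field,finite} ^ 'n) set set"
    and p :: "int poly"
  assumes "primepow q" and "CARD('a) = q"
    and "n > 0" and "CARD('n) = n"
    and "N = (q ^ n - 1) div (q - 1)"
    and "N' = N - n"
    and "k = q ^ (n - 1) - 1"
    and "E = PG_points"
    and "p = char_poly E (dual_rank E PG_rank)"
  shows "(\<forall>d > N'. coeff p d = 0) \<and>
         (\<forall>i < k. coeff p (N' - i) = (-1) ^ i * int (N choose i))"
proof -
  interpret D: matroid E "dual_rank E PG_rank"
    unfolding \<open>E = PG_points\<close> by (intro matroid.matroid_dual matroid_PG)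
  have "q > 1"
    using primepow_gt_Suc_0[OF \<open>primepow q\<close>] by simp
  have "card E * (q - 1) = q ^ n - 1"
    using card_PG_points[where 'a='a and 'n='n] assms by simp
  then have "(q ^ n - 1) div (q - 1) = card E"
    using \<open>q > 1\<close> nonzero_mult_div_cancel_right[of "q - 1" "card E"] by simp
  then have N: "card E = N"
    using assms by simp
  have rank_E: "PG_rank E = n"
    using PG_rank_PG_points[where 'a='a and 'n='n] assms by simp
  have rank_empty: "PG_rank ({} :: ('a ^ 'n) set set) = 0"
    by (simp add: PG_rank_def)
  have card_ge: "q ^ (n - 1) \<le> card A" if "A \<subseteq> E" "PG_rank (E - A) < n" for A
    using card_ge_if_complement_not_spanning[of A] that assms by simp
  \<comment> \<open>The bound \<open>card_ge\<close> applies to \<open>E\<close> itself: its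
    complement is empty and has rank \<open>0 < n\<close>.\<close>
  have "k \<le> card E"
    using card_ge[of E] rank_empty \<open>n > 0\<close> \<open>k = _\<close> by simp
  have indep: "dual_rank E PG_rank A = card A" if A: "A \<subseteq> E" "card A \<le> k" for A
  proof -
    \<comment> \<open>Since \<open>q ^ (n - 1)\<close> is positive, the subtraction in
      \<open>k\<close> is genuine and at most \<open>k\<close> means strictly below this
      power.\<close>
    have "card A < q ^ (n - 1)"
      using A(2) \<open>q > 1\<close> \<open>k = _\<close> by (simp add: le_diff_conv2 less_eq_Suc_le)
    then have "PG_rank (E - A) \<ge> n"
      using card_ge[OF A(1)] by (meson not_le)
    moreover have "PG_rank (E - A) \<le> PG_rank E"
      using matroid.rank_mono[OF matroid_PG, of "E - A" E] \<open>E = PG_points\<close> by auto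
    \<comment> \<open>The complement has full rank \<open>n\<close>, which cancels against the rank
      of \<open>E\<close> in the dual rank and leaves \<open>card A\<close>.\<close>
    ultimately show ?thesis
      by (simp add: dual_rank_def rank_E)
  qed
  have dual_rank_E: "dual_rank E PG_rank E = N'"
    using rank_empty by (simp add: dual_rank_def rank_E N \<open>N' = _\<close>)
  show ?thesis
  proof (intro conjI allI impI)
    fix d assume "d > N'"
    then show "coeff p d = 0"
      using D.degree_char_poly_le unfolding \<open>p = _\<close> dual_rank_E by (intro coeff_eq_0) simp
  next
    fix i assume "i < k"
    then show "coeff p (N' - i) = (-1) ^ i * int (N choose i)"
      using D.coeff_char_poly_of_small_sets_independent[OF indep \<open>k \<le> card E\<close>]
      unfolding \<open>p = _\<close> dual_rank_E N by simp
  qed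
qed

end
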